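(* Let $r,s,t$ be integers with $1\leq r\leq s\leq t$ and $r\geq 5$. Then the graph $\Delta_{r,s,t}$ has no interval coloring, i.e. $\Delta_{r,s,t}\notin \mathfrak{N}$.
   Context: All graphs are finite, without loops or multiple edges. For a graph $G$ and a proper edge-coloring $\alpha$, $S(v,\alpha)$ denotes the set of colors of edges incident to $v$. An interval $t$-coloring of $G$ is a proper edge-coloring of $G$ with colors $1,\ldots,t$ such that every color is used and for every vertex $v$ the set $S(v,\alpha)$ is an interval of integers. $\mathfrak{N}$ denotes the set of graphs having an interval $t$-coloring for some positive integer $t$. For $1\leq r\leq s\leq t$, the graph $\Delta_{r,s,t}$ has vertex set $\{v,x,y,z\}\cup\{a_1,\ldots,a_r,b_1,\ldots,b_s,c_1,\ldots,c_t\}$ and edge set $\{va_i,xa_i,ya_i:1\leq i\leq r\}\cup\{vb_j,xb_j,zb_j:1\leq j\leq s\}\cup\{vc_k,yc_k,zc_k:1\leq k\leq t\}$. It is a connected bipartite graph with maximum degree $r+s+t$. *)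

theory Defs
  imports Main
begin

record 'a ugraph =
  verts :: "'a set"
  edges :: "'a set set"

definition simple_graph :: "'a ugraph \<Rightarrow> bool" where
  "simple_graph G \<longleftrightarrow>
     finite (verts G) \<and> (\<forall>e\<in>edges G. e \<subseteq> verts G \<and> card e = 2)"

definition proper_edge_coloring :: "'a ugraph \<Rightarrow> ('a set \<Rightarrow> nat) \<Rightarrow> bool" where
  "proper_edge_coloring G \<alpha> \<longleftrightarrow>
     (\<forall>e\<in>edges G. \<forall>f\<in>edges G. e \<noteq> f \<and> e \<inter> f \<noteq> {} \<longrightarrow> \<alpha> e \<noteq> \<alpha> f)"

definition spectrum :: "'a ugraph \<Rightarrow> 'a \<Rightarrow> ('a set \<Rightarrow> nat) \<Rightarrow> nat set" where
  "spectrum G v \<alpha> = \<alpha> ` {e \<in> edges G. v \<in> e}"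

text \<open>The set of colors at an isolated vertex is empty, which counts as an interval
  (\<open>{m..n}\<close> with \<open>n < m\<close>).\<close>

definition interval_coloring :: "'a ugraph \<Rightarrow> nat \<Rightarrow> ('a set \<Rightarrow> nat) \<Rightarrow> bool" where
  "interval_coloring G t \<alpha> \<longleftrightarrow>
     proper_edge_coloring G \<alpha> \<and> \<alpha> ` edges G = {1..t} \<and>
     (\<forall>v\<in>verts G. \<exists>m n. spectrum G v \<alpha> = {m..n})"

definition interval_colorable :: "'a ugraph set" ("\<NN>") where
  "\<NN> = {G. simple_graph G \<and> (\<exists>t\<ge>1. \<exists>\<alpha>. interval_coloring G t \<alpha>)}"

datatype delta_vertex = V | X | Y | Z | A nat | B nat | C nat

definition Delta :: "nat \<Rightarrow> nat \<Rightarrow> nat \<Rightarrow> delta_vertex ugraph" where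
  "Delta r s t =
     \<lparr> verts = {V, X, Y, Z} \<union> A ` {1..r} \<union> B ` {1..s} \<union> C ` {1..t},
       edges = (\<Union>i\<in>{1..r}. {{V, A i}, {X, A i}, {Y, A i}})
             \<union> (\<Union>j\<in>{1..s}. {{V, B j}, {X, B j}, {Z, B j}})
             \<union> (\<Union>k\<in>{1..t}. {{V, C k}, {Y, C k}, {Z, C k}}) \<rparr>"

text \<open>Hence non-membership of \<open>Delta r s t\<close> in \<open>\<NN>\<close> is never due to the conjunct
  \<open>simple_graph\<close>.\<close>

lemma simple_graph_Delta: "simple_graph (Delta r s t)"
  by (auto simp: simple_graph_def Delta_def)

end

theory Submission
  imports Defs
begin

text \<open>The hub \<open>V\<close> sees \<open>r + s + t\<close> consecutive colors. Let \<open>p\<close> and \<open>q\<close> be its neighbors along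
  the edges of least and greatest color. They are also joined by one of the hubs \<open>X\<close>, \<open>Y\<close>, \<open>Z\<close>,
  whose degree is at most \<open>s + t\<close>. Since \<open>p\<close> and \<open>q\<close> have degree 3, moving from \<open>V\<close> to that hub
  changes each of the two colors by at most 2, so \<open>r + s + t \<le> s + t + 4\<close>.\<close>

definition nbhd :: "'a ugraph \<Rightarrow> 'a \<Rightarrow> 'a set" where
  "nbhd G v = {w. {v, w} \<in> edges G}"

lemma nbhd_sym: "w \<in> nbhd G v \<longleftrightarrow> v \<in> nbhd G w"
  by (simp add: nbhd_def insert_commute)

lemma nbhd_subset_verts:
  assumes "simple_graph G"
  shows "nbhd G v \<subseteq> verts G"
  using assms by (auto simp: simple_graph_def nbhd_def)

lemma finite_nbhd: "simple_graph G \<Longrightarrow> finite (nbhd G v)"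
  by (meson finite_subset nbhd_subset_verts simple_graph_def)

text \<open>Every edge has exactly two elements, so the edges at \<open>v\<close> are the sets
  \<open>{v, w}\<close> with \<open>w\<close> a neighbor. Degrees can then be counted by
  neighbors.\<close>

lemma spectrum_eq_image_nbhd:
  assumes "simple_graph G"
  shows "spectrum G v \<alpha> = (\<lambda>w. \<alpha> {v, w}) ` nbhd G v"
proof -
  have "{e \<in> edges G. v \<in> e} = (\<lambda>w. {v, w}) ` nbhd G v"
  proof (intro equalityI subsetI)
    fix e assume e: "e \<in> {e \<in> edges G. v \<in> e}"
    then have "card e = 2" using assms by (auto simp: simple_graph_def)
    then obtain x y where "e = {x, y}" by (auto simp: card_2_iff)
    with e show "e \<in> (\<lambda>w. {v, w}) ` nbhd G v"
      by (auto simp: nbhd_def insert_commute)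
  qed (auto simp: nbhd_def)
  then show ?thesis by (simp add: spectrum_def image_image)
qed

lemma card_spectrum_le:
  assumes "simple_graph G"
  shows "card (spectrum G v \<alpha>) \<le> card (nbhd G v)"
  by (simp add: assms spectrum_eq_image_nbhd card_image_le finite_nbhd)

lemma card_spectrum:
  assumes "simple_graph G" and "proper_edge_coloring G \<alpha>"
  shows "card (spectrum G v \<alpha>) = card (nbhd G v)"
proof -
  have "inj_on (\<lambda>w. \<alpha> {v, w}) (nbhd G v)"
  proof (rule inj_onI, rule ccontr)
    fix x y assume *: "x \<in> nbhd G v" "y \<in> nbhd G v" "\<alpha> {v, x} = \<alpha> {v, y}" "x \<noteq> y"
    then have "{v, x} \<noteq> {v, y}" by (simp add: doubleton_eq_iff)
    with * assms(2) show False by (auto simp: proper_edge_coloring_def nbhd_def)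
  qed
  then show ?thesis by (simp add: assms(1) spectrum_eq_image_nbhd card_image)
qed

text \<open>The spectrum at \<open>v\<close> is an interval with at most as many colors as
  \<open>v\<close> has neighbors, so its ends differ by less than the degree.\<close>

lemma interval_coloring_diff_less_degree:
  assumes "simple_graph G" and "interval_coloring G t \<alpha>"
    and "v \<in> verts G" and "a \<in> nbhd G v" and "b \<in> nbhd G v"
  shows "\<alpha> {v, a} < \<alpha> {v, b} + card (nbhd G v)"
proof -
  obtain m n where mn: "spectrum G v \<alpha> = {m..n}"
    using assms(2,3) unfolding interval_coloring_def by blast
  have "\<alpha> {v, a} \<in> {m..n}" "\<alpha> {v, b} \<in> {m..n}"
    using assms(4,5) by (auto simp: assms(1) spectrum_eq_image_nbhd simp flip: mn)
  then show ?thesis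
    using card_spectrum_le[OF assms(1), of v \<alpha>] by (auto simp: mn)
qed

text \<open>The counting argument in general form. The hub \<open>h\<close> may depend on the pair
  \<open>p\<close>, \<open>q\<close>; it is applied to the ends of the edges of extreme color at
  \<open>v\<close>. The summand 4 is a change of at most 2 at each of \<open>p\<close> and
  \<open>q\<close>.\<close>

lemma degree_le_if_neighbors_joined:
  assumes simple: "simple_graph G" and col: "interval_coloring G t \<alpha>" and v: "v \<in> verts G"
    and deg3: "\<And>p. p \<in> nbhd G v \<Longrightarrow> card (nbhd G p) \<le> 3"
    and hub: "\<And>p q. p \<in> nbhd G v \<Longrightarrow> q \<in> nbhd G v \<Longrightarrow>
      \<exists>h. p \<in> nbhd G h \<and> q \<in> nbhd G h \<and> card (nbhd G h) \<le> d"
  shows "card (nbhd G v) \<le> d + 4"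
proof (cases "nbhd G v = {}")
  case False
  obtain m n where mn: "spectrum G v \<alpha> = {m..n}"
    using col v unfolding interval_coloring_def by blast
  have "spectrum G v \<alpha> \<noteq> {}"
    using False by (simp add: simple spectrum_eq_image_nbhd)
  then have "m \<in> spectrum G v \<alpha>" "n \<in> spectrum G v \<alpha>"
    by (auto simp: mn)
  then obtain p q where p: "p \<in> nbhd G v" "\<alpha> {v, p} = m" and q: "q \<in> nbhd G v" "\<alpha> {v, q} = n"
    by (auto simp: simple spectrum_eq_image_nbhd)
  obtain h where h: "p \<in> nbhd G h" "q \<in> nbhd G h" "card (nbhd G h) \<le> d"
    using hub p(1) q(1) by blast
  have verts: "p \<in> verts G" "q \<in> verts G" "h \<in> verts G"
    using h p(1) q(1) nbhd_subset_verts[OF simple] nbhd_sym[of p G h] by blast+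
  \<comment> \<open>Both edges \<open>{h, p}\<close> and \<open>{v, p}\<close> meet at
    \<open>p\<close>, whose degree is at most 3.\<close>
  have "\<alpha> {h, p} < \<alpha> {v, p} + 3"
    using interval_coloring_diff_less_degree[OF simple col verts(1), of h v] deg3[OF p(1)] p(1) h(1)
    by (simp add: nbhd_sym[of p] insert_commute)
  moreover have "\<alpha> {v, q} < \<alpha> {h, q} + 3"
    using interval_coloring_diff_less_degree[OF simple col verts(2), of v h] deg3[OF q(1)] q(1) h(2)
    by (simp add: nbhd_sym[of q] insert_commute)
  moreover have "\<alpha> {h, q} < \<alpha> {h, p} + d"
    using interval_coloring_diff_less_degree[OF simple col verts(3) h(2,1)] h(3) by linarith
  \<comment> \<open>Properness makes the colors at \<open>v\<close> distinct, so the degree equals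
    the length of the interval. The chain above gives n \<le> m + d + 3.\<close>
  moreover have "card (nbhd G v) = Suc n - m"
    using card_spectrum[OF simple, of \<alpha> v] col by (simp add: interval_coloring_def mn)
  ultimately show ?thesis using p(2) q(2) by linarith
qed simp

lemma nbhd_Delta_hubs:
  "nbhd (Delta r s t) V = A ` {1..r} \<union> B ` {1..s} \<union> C ` {1..t}"
  "nbhd (Delta r s t) X = A ` {1..r} \<union> B ` {1..s}"
  "nbhd (Delta r s t) Y = A ` {1..r} \<union> C ` {1..t}"
  "nbhd (Delta r s t) Z = B ` {1..s} \<union> C ` {1..t}"
  by (auto simp: nbhd_def Delta_def doubleton_eq_iff)

text \<open>Inclusions suffice to bound the degree by 3, and they hold also for an index out of
  range, where the neighborhood is empty.\<close>

lemma nbhd_Delta_subsets: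
  "nbhd (Delta r s t) (A i) \<subseteq> {V, X, Y}"
  "nbhd (Delta r s t) (B i) \<subseteq> {V, X, Z}"
  "nbhd (Delta r s t) (C i) \<subseteq> {V, Y, Z}"
  by (auto simp: nbhd_def Delta_def doubleton_eq_iff)

lemma card_nbhd_Delta_hubs:
  "card (nbhd (Delta r s t) V) = r + s + t"
  "card (nbhd (Delta r s t) X) = r + s"
  "card (nbhd (Delta r s t) Y) = r + t"
  "card (nbhd (Delta r s t) Z) = s + t"
proof -
  have "card (A ` {1..r}) = r" "card (B ` {1..s}) = s" "card (C ` {1..t}) = t"
    by (auto simp: card_image inj_on_def)
  moreover have "A ` {1..r} \<inter> B ` {1..s} = {}" "A ` {1..r} \<inter> C ` {1..t} = {}"
    "B ` {1..s} \<inter> C ` {1..t} = {}"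
    by auto
  ultimately show "card (nbhd (Delta r s t) V) = r + s + t"
    "card (nbhd (Delta r s t) X) = r + s"
    "card (nbhd (Delta r s t) Y) = r + t"
    "card (nbhd (Delta r s t) Z) = s + t"
    unfolding nbhd_Delta_hubs by (simp_all add: card_Un_disjoint Int_Un_distrib2)
qed

theorem theorem6:
  fixes r s t :: nat
  assumes "1 \<le> r" and "r \<le> s" and "s \<le> t" and "5 \<le> r"
  shows "Delta r s t \<notin> \<NN>"
proof
  let ?G = "Delta r s t"
  assume "?G \<in> \<NN>"
  then obtain k \<alpha> where col: "interval_coloring ?G k \<alpha>"
    by (auto simp: interval_colorable_def)
  have "card (nbhd ?G V) \<le> (s + t) + 4"
  proof (rule degree_le_if_neighbors_joined[OF simple_graph_Delta col])
    show "V \<in> verts ?G" by (simp add: Delta_def)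
  next
    fix p assume "p \<in> nbhd ?G V"
    then obtain a b c where "nbhd ?G p \<subseteq> {a, b, c}"
      unfolding nbhd_Delta_hubs using nbhd_Delta_subsets by blast
    then have "card (nbhd ?G p) \<le> card {a, b, c}" by (simp add: card_mono)
    \<comment> \<open>Only an upper bound, since \<open>a\<close>, \<open>b\<close>,
      \<open>c\<close> are not known to be distinct here.\<close>
    also have "\<dots> \<le> 3" by (simp add: card_insert_if)
    finally show "card (nbhd ?G p) \<le> 3" .
  next
    fix p q assume "p \<in> nbhd ?G V" "q \<in> nbhd ?G V"
    \<comment> \<open>Each of the classes \<open>A\<close>, \<open>B\<close>, \<open>C\<close> is
      joined to two of the three hubs \<open>X\<close>, \<open>Y\<close>, \<open>Z\<close>, so any
      two classes share a hub.\<close>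
    then have "p \<in> nbhd ?G X \<and> q \<in> nbhd ?G X \<or> p \<in> nbhd ?G Y \<and> q \<in> nbhd ?G Y
        \<or> p \<in> nbhd ?G Z \<and> q \<in> nbhd ?G Z"
      unfolding nbhd_Delta_hubs by blast
    moreover have "card (nbhd ?G X) \<le> s + t" "card (nbhd ?G Y) \<le> s + t" "card (nbhd ?G Z) \<le> s + t"
      using assms by (simp_all add: card_nbhd_Delta_hubs)
    ultimately show "\<exists>h. p \<in> nbhd ?G h \<and> q \<in> nbhd ?G h \<and> card (nbhd ?G h) \<le> s + t"
      by blast
  qed
  \<comment> \<open>The degree of \<open>V\<close> is r + s + t, so the bound would force r \<le>
    4.\<close>
  then show False using assms by (simp add: card_nbhd_Delta_hubs)
qed

end
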